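(* For every integer $n\ge 1$, the map $\phi$ (defined in the context) is a bijection from the set of ballot-admissible Fibonacci ribbons of length $n$ to the set of peakless Motzkin paths of length $n$.
   Context: Shapes. For $n\ge 1$, the Fibonacci ribbon shape of length $n$ is the skew shape $P/Q$ (English convention, left-justified rows; row $i$ consists of the boxes in positions $q_i+1,\dots,p_i$) with $P=(n,n-1,n-3,n-5,\dots)$ and $Q=(n-2,n-4,\dots)$, where entries decrease to zero rather than becoming negative. It has exactly $n$ columns; columns are numbered $1,\dots,n$ from right to left; column $i$ has 1 box if $i$ is odd and 2 boxes if $i$ is even. Ribbons. A Fibonacci ribbon of length $n$ is a filling $r$ of this shape with entries in $\{1,2,3\}$ that is semistandard (rows weakly increasing from left to right, columns strictly increasing from top to bottom). $r(i)$ denotes the $i$-th column from the right, written as the list of its entries from top to bottom in parentheses, e.g. $(12)$ or $(2)$. For $1\le x\le y\le n$, $r([x,y])$ denotes the part of $r$ formed by columns $x,\dots,y$, and $\mu_i(r([x,y]))$ is the number of entries equal to $i$ in it. The linear form of $r$ is the word obtained by reading the columns from right to left, each column from top to bottom. $r$ is ballot-admissible if in every prefix of its linear form the number of $1$s is at least the number of $2$s, and the number of $2$s is at least the number of $3$s. Bonds. For $i\in\{1,2\}$ and a column $c$ of $r$ containing the entry $i+1$, $b_i(c)$ is the maximal column $y\le c$ such that $\mu_i(r([y,c]))=\mu_{i+1}(r([y,c]))$, if one exists. A column $c$ is bonded if there are a column $d>c$ and $i\in\{1,2\}$ with $b_i(d)=c$ (so "bonded" always means bonded to a later column). A column $c$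 is unbonded if for some $i\in\{1,2\}$ the column $r(c)$ has an $i$ entry and no $i+1$ entry and $c$ is not in the image of $b_i$. Paths. Let $N=(1,1)$, $E=(1,0)$, $S=(1,-1)$. A peakless Motzkin path of length $n$ is a lattice walk on $\mathbb{Z}^2$ with steps in $\{N,E,S\}$ starting at $(0,0)$, ending at $(n,0)$, always staying at $y\ge 0$, and in which an $N$ step is never immediately followed by an $S$ step. The map. For a ballot-admissible Fibonacci ribbon $r$ of length $n$, $\phi(r)$ is the lattice walk with $n$ steps whose $i$-th step is: $N$ if $r(i)$ is a bonded $(12)$ or a bonded $(1)$; $E$ if $r(i)$ is an unbonded $(12)$ or $(1)$, or a bonded $(13)$ or $(2)$; $S$ if $r(i)$ is an unbonded $(13)$ or $(2)$, or if $r(i)$ is $(23)$ or $(3)$. *)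

theory Defs
  imports Main "HOL-Library.FuncSet" "HOL-Library.Product_Plus"
begin

text \<open>
  A box is a pair (row, position); rows are counted from 1 downwards and positions from 1
  rightwards. Truncated subtraction on \<^typ>\<open>nat\<close> makes the parts of
  P = (n, n - 1, n - 3, \<dots>) and Q = (n - 2, n - 4, \<dots>) stop at zero.
\<close>

type_synonym box = "nat \<times> nat"

definition skew_shape :: "(nat \<Rightarrow> nat) \<Rightarrow> (nat \<Rightarrow> nat) \<Rightarrow> box set" where
  "skew_shape P Q = {(i, j). 1 \<le> i \<and> Q i < j \<and> j \<le> P i}"

definition fib_P :: "nat \<Rightarrow> nat \<Rightarrow> nat" where
  "fib_P n i = (if i = 1 then n else n - (2 * i - 3))"

definition fib_Q :: "nat \<Rightarrow> nat \<Rightarrow> nat" where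
  "fib_Q n i = n - 2 * i"

definition fib_shape :: "nat \<Rightarrow> box set" where
  "fib_shape n = skew_shape (fib_P n) (fib_Q n)"

definition semistandard :: "box set \<Rightarrow> (box \<Rightarrow> nat) \<Rightarrow> bool" where
  "semistandard D r \<longleftrightarrow>
     (\<forall>i j k. (i, j) \<in> D \<and> (i, k) \<in> D \<and> j < k \<longrightarrow> r (i, j) \<le> r (i, k)) \<and>
     (\<forall>i k j. (i, j) \<in> D \<and> (k, j) \<in> D \<and> i < k \<longrightarrow> r (i, j) < r (k, j))"

text \<open>
  Fillings are extensional functions (\<^term>\<open>undefined\<close> outside the shape), so that distinct
  functions are distinct fillings.
\<close>

definition fib_ribbons :: "nat \<Rightarrow> (box \<Rightarrow> nat) set" where
  "fib_ribbons n = {r \<in> fib_shape n \<rightarrow>\<^sub>E {1, 2, 3}. semistandard (fib_shape n) r}"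

text \<open>Columns are numbered from right to left, so column c consists of the boxes at position n + 1 - c.\<close>

definition rcol :: "nat \<Rightarrow> (box \<Rightarrow> nat) \<Rightarrow> nat \<Rightarrow> nat list" where
  "rcol n r c = map (\<lambda>i. r (i, n + 1 - c)) (sorted_list_of_set {i. (i, n + 1 - c) \<in> fib_shape n})"

definition linear_form :: "nat \<Rightarrow> (box \<Rightarrow> nat) \<Rightarrow> nat list" where
  "linear_form n r = concat (map (rcol n r) [1..<n + 1])"

definition ballot_admissible :: "nat \<Rightarrow> (box \<Rightarrow> nat) \<Rightarrow> bool" where
  "ballot_admissible n r \<longleftrightarrow>
     (\<forall>k. count_list (take k (linear_form n r)) 2 \<le> count_list (take k (linear_form n r)) 1 \<and>
          count_list (take k (linear_form n r)) 3 \<le> count_list (take k (linear_form n r)) 2)"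

definition ballot_fib_ribbons :: "nat \<Rightarrow> (box \<Rightarrow> nat) set" where
  "ballot_fib_ribbons n = {r \<in> fib_ribbons n. ballot_admissible n r}"

text \<open>\<open>mu n r i x y\<close> counts the entries equal to i in columns x to y.\<close>

definition mu :: "nat \<Rightarrow> (box \<Rightarrow> nat) \<Rightarrow> nat \<Rightarrow> nat \<Rightarrow> nat \<Rightarrow> nat" where
  "mu n r i x y = (\<Sum>c = x..y. count_list (rcol n r c) i)"

definition bond :: "nat \<Rightarrow> (box \<Rightarrow> nat) \<Rightarrow> nat \<Rightarrow> nat \<Rightarrow> nat option" where
  "bond n r i c =
     (let Y = {y \<in> {1..c}. mu n r i y c = mu n r (i + 1) y c}
      in if i + 1 \<in> set (rcol n r c) \<and> Y \<noteq> {} then Some (Max Y) else None)"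

definition bonded :: "nat \<Rightarrow> (box \<Rightarrow> nat) \<Rightarrow> nat \<Rightarrow> bool" where
  "bonded n r c \<longleftrightarrow> (\<exists>d\<in>{1..n}. \<exists>i\<in>{1, 2}. c < d \<and> bond n r i d = Some c)"

text \<open>Unbondedness is not literally the negation of bondedness: it is tied to one particular i.\<close>

definition unbonded :: "nat \<Rightarrow> (box \<Rightarrow> nat) \<Rightarrow> nat \<Rightarrow> bool" where
  "unbonded n r c \<longleftrightarrow>
     (\<exists>i\<in>{1, 2}. i \<in> set (rcol n r c) \<and> i + 1 \<notin> set (rcol n r c) \<and>
        \<not> (\<exists>d\<in>{1..n}. bond n r i d = Some c))"

type_synonym vec = "int \<times> int"

definition stepN :: vec where "stepN = (1, 1)"
definition stepE :: vec where "stepE = (1, 0)"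
definition stepS :: vec where "stepS = (1, -1)"

text \<open>A walk starting at the origin is given by the list of its steps.\<close>

definition walk_pos :: "vec list \<Rightarrow> nat \<Rightarrow> vec" where
  "walk_pos w k = sum_list (take k w)"

definition peakless_motzkin_paths :: "nat \<Rightarrow> vec list set" where
  "peakless_motzkin_paths n =
     {w. length w = n \<and> set w \<subseteq> {stepN, stepE, stepS} \<and>
         walk_pos w n = (int n, 0) \<and>
         (\<forall>k\<le>n. 0 \<le> snd (walk_pos w k)) \<and>
         (\<forall>k. k + 1 < n \<longrightarrow> \<not> (w ! k = stepN \<and> w ! (k + 1) = stepS))}"

text \<open>
  The three cases are mutually exclusive and exhaust the columns of a ballot-admissible
  Fibonacci ribbon, so the final \<^term>\<open>undefined\<close> is never reached for such ribbons.
\<close>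

definition phi_step :: "nat \<Rightarrow> (box \<Rightarrow> nat) \<Rightarrow> nat \<Rightarrow> vec" where
  "phi_step n r c =
     (let col = rcol n r c in
      if col \<in> {[1, 2], [1]} \<and> bonded n r c then stepN
      else if col \<in> {[1, 2], [1]} \<and> unbonded n r c \<or> col \<in> {[1, 3], [2]} \<and> bonded n r c then stepE
      else if col \<in> {[1, 3], [2]} \<and> unbonded n r c \<or> col \<in> {[2, 3], [3]} then stepS
      else undefined)"

definition phi :: "nat \<Rightarrow> (box \<Rightarrow> nat) \<Rightarrow> vec list" where
  "phi n r = map (phi_step n r) [1..<n + 1]"

end

theory Submission
  imports Defs
begin

text \<open>
  Fix i in {1, 2} and read a column as an opening parenthesis if it contains i but not i + 1, as a
  closing one if it contains i + 1 but not i, and as neutral otherwise. The bond of a closing column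
  is then its partner in the usual matching of parentheses, and a column is bonded exactly if, for
  one of the two values of i, it is an opening column with a partner (\<open>bonded_iff\<close>). Inside a column
  the entries increase, so ballot admissibility is not lost between the boxes of a column and only
  says that every closing column has a partner (\<open>ballot_admissible_iff\<close>).

  Cut the ribbon after column k and let x and y be the numbers of closing columns to come, for i = 1
  and i = 2, whose partners are not among the columns to come. For a ballot ribbon these are the
  bonds that cross the cut. Going backwards over a column of weight w (1, - 1 or 0 for opening,
  closing, neutral) turns x into max 0 (x - w), and an opening column is bonded iff the value after
  it is positive. Hence the step assigned to a column depends only on the column and on the pair
  (x, y) after it (\<open>phi_step_eq_step_of\<close>), and its height is the change of x + y: up for a new bond,
  down for a closed one. The walk therefore has height x + y after k steps, which is never negative
  and is 0 at both ends.

  The point of the bijection is that this automaton, although defined backwards, can be run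
  forwards. Knowing the pair before a column and the step, one recovers the column and the pair after
  it (\<open>decode_step_of\<close>), because a column opening an unmatched parenthesis of type i can occur only
  when no bond of type i crosses the cut. This gives injectivity. Conversely, as long as the height
  stays nonnegative the decoder always produces a legal column (\<open>step_of_decode\<close>), and the states it
  passes through are the true numbers of crossing bonds because they satisfy the same backward
  recursion (\<open>excess_unique\<close>). The decoded columns strictly increase; the
  remaining condition, that rows weakly increase, fails between two columns exactly when the
  corresponding steps form a peak (\<open>row_condition_iff_no_peak\<close>). This gives surjectivity.
\<close>

section \<open>Matching parentheses by prefix sums\<close>

definition bal :: "(nat \<Rightarrow> int) \<Rightarrow> nat \<Rightarrow> int" where
  "bal w k = (\<Sum>c = 1..k. w c)"

text \<open>
  For w with values in {- 1, 0, 1} the drop of the prefix sums below their value at k counts the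
  closing positions after k that find no partner after k.
\<close>

definition excess :: "(nat \<Rightarrow> int) \<Rightarrow> nat \<Rightarrow> nat \<Rightarrow> int" where
  "excess w n k = bal w k - Min (bal w ` {k..n})"

lemma bal_0 [simp]: "bal w 0 = 0"
  by (simp add: bal_def)

lemma bal_Suc [simp]: "bal w (Suc k) = bal w k + w (Suc k)"
  by (simp add: bal_def)

lemma excess_end [simp]: "excess w n n = 0"
  by (simp add: excess_def)

lemma excess_nonneg: "k \<le> n \<Longrightarrow> 0 \<le> excess w n k"
  by (simp add: excess_def Min_le_iff)

lemma excess_pos_iff:
  assumes "k \<le> n"
  shows "0 < excess w n k \<longleftrightarrow> (\<exists>d\<in>{k..n}. bal w d < bal w k)"
  using assms by (auto simp: excess_def Min_less_iff)

lemma excess_step: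
  assumes "k < n"
  shows "excess w n k = max 0 (excess w n (Suc k) - w (Suc k))"
proof -
  have "{k..n} = insert k {Suc k..n}" using assms by auto
  then have "Min (bal w ` {k..n}) = min (bal w k) (Min (bal w ` {Suc k..n}))"
    using assms by simp
  then show ?thesis by (simp add: excess_def)
qed

text \<open>
  The recursion and the final value determine the excess, so a sequence of states found by other
  means can be recognised as the excess without looking at the matching.
\<close>

lemma excess_unique:
  assumes "X n = 0" and "\<And>k. k < n \<Longrightarrow> X k = max 0 (X (Suc k) - w (Suc k))" and "k \<le> n"
  shows "X k = excess w n k"
  using assms(3)
proof (induction rule: inc_induct)
  case base
  then show ?case by (simp add: assms(1))
next
  case (step m)
  then show ?case by (simp add: assms(2) excess_step)
qed

lemma excess_0_iff: "excess w n 0 = 0 \<longleftrightarrow> (\<forall>k\<le>n. 0 \<le> bal w k)"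
  using excess_pos_iff[of 0 n w] excess_nonneg[of 0 n w]
  by (force simp: not_less)

text \<open>
  The left side says that d closes the parenthesis opened at position k + 1: the prefix sum
  comes back at d to the level it had before k + 1, and not earlier. Since the prefix sums move by at
  most 1, they cannot jump over that level, so coming back at all means going below the level reached
  at k + 1. The converse takes the first d that does so.
\<close>

lemma first_return_iff:
  assumes w: "\<And>c. c \<in> {1..n} \<Longrightarrow> \<bar>w c\<bar> \<le> 1" and "k < n"
  shows "(\<exists>d\<in>{Suc k<..n}. w d = - 1 \<and> bal w k = bal w d \<and> (\<forall>z\<in>{Suc k..<d}. bal w z \<noteq> bal w d))
     \<longleftrightarrow> w (Suc k) = 1 \<and> 0 < excess w n (Suc k)"
    (is "?L \<longleftrightarrow> ?R")
proof
  assume ?L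
  then obtain d where d: "Suc k < d" "d \<le> n" "w d = - 1" "bal w k = bal w d"
    and nz: "\<And>z. Suc k \<le> z \<Longrightarrow> z < d \<Longrightarrow> bal w z \<noteq> bal w d"
    by auto
  obtain e where e: "d = Suc e" using d by (cases d) auto
  \<comment> \<open>Backwards from d: the prefix sum is one higher at d - 1 and cannot cross the level of d
    without hitting it.\<close>
  have above: "bal w d < bal w z" if "Suc k \<le> z" "z \<le> e" for z
    using that(2,1)
  proof (induction rule: inc_induct)
    case base
    then show ?case using d e by simp
  next
    case (step z)
    then show ?case using nz[of z] w[of "Suc z"] d e by force
  qed
  from above[of "Suc k"] d e have "bal w d < bal w (Suc k)" by simp
  then have "0 < excess w n (Suc k)"
    using \<open>k < n\<close> d \<open>bal w d < bal w (Suc k)\<close>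
    by (subst excess_pos_iff) (auto simp del: bal_Suc)
  moreover have "w (Suc k) = 1"
    using \<open>bal w d < bal w (Suc k)\<close> d w[of "Suc k"] by auto
  ultimately show ?R by simp
next
  assume ?R
  then have w1: "w (Suc k) = 1" and ex: "\<exists>d. d \<in> {Suc k..n} \<and> bal w d < bal w (Suc k)"
    using \<open>k < n\<close> by (auto simp: excess_pos_iff)
  define d where "d = (LEAST d. d \<in> {Suc k..n} \<and> bal w d < bal w (Suc k))"
  have d: "d \<in> {Suc k..n}" "bal w d < bal w (Suc k)"
    using LeastI_ex[OF ex] by (auto simp: d_def)
  have least: "bal w (Suc k) \<le> bal w z" if "z \<in> {Suc k..<d}" for z
    using that d(1) not_less_Least[of z "\<lambda>d. d \<in> {Suc k..n} \<and> bal w d < bal w (Suc k)"]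
    by (force simp: d_def)
  have "d \<noteq> Suc k" using d(2) by auto
  then obtain e where e: "d = Suc e" "Suc k \<le> e" using d(1) by (cases d) auto
  have "w d = - 1" "bal w d = bal w k"
    using least[of e] e d w1 w[of d] by auto
  moreover have "\<forall>z\<in>{Suc k..<d}. bal w z \<noteq> bal w d"
    using least d(2) by force
  ultimately show ?L using d e by (intro bexI[of _ d]) auto
qed


section \<open>Columns\<close>

definition cols :: "nat \<Rightarrow> nat list set" where
  "cols c = (if odd c then {[1], [2], [3]} else {[1, 2], [1, 3], [2, 3]})"

definition weight :: "nat \<Rightarrow> nat list \<Rightarrow> int" where
  "weight i xs = int (count_list xs i) - int (count_list xs (i + 1))"

lemma weight_append [simp]: "weight i (xs @ ys) = weight i xs + weight i ys"
  by (simp add: weight_def)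

lemma weight_Nil [simp]: "weight i [] = 0"
  by (simp add: weight_def)

lemma cols_cases:
  assumes "col \<in> cols c"
  obtains "odd c" "col = [1]" | "odd c" "col = [2]" | "odd c" "col = [3]"
    | "even c" "col = [1, 2]" | "even c" "col = [1, 3]" | "even c" "col = [2, 3]"
  using assms by (auto simp: cols_def split: if_splits)

lemma weight_col:
  "weight (Suc 0) [Suc 0] = 1" "weight 2 [Suc 0] = 0"
  "weight (Suc 0) [2] = - 1" "weight 2 [2] = 1"
  "weight (Suc 0) [3] = 0" "weight 2 [3] = - 1"
  "weight (Suc 0) [Suc 0, 2] = 0" "weight 2 [Suc 0, 2] = 1"
  "weight (Suc 0) [Suc 0, 3] = 1" "weight 2 [Suc 0, 3] = - 1"
  "weight (Suc 0) [2, 3] = - 1" "weight 2 [2, 3] = 0"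
  by (simp_all add: weight_def)

lemma abs_weight_col: "col \<in> cols c \<Longrightarrow> i \<in> {1, 2} \<Longrightarrow> \<bar>weight i col\<bar> \<le> 1"
  by (elim cols_cases) (auto simp: weight_col)

lemma weight_eq_1_iff:
  "col \<in> cols c \<Longrightarrow> i \<in> {1, 2} \<Longrightarrow> weight i col = 1 \<longleftrightarrow> i \<in> set col \<and> i + 1 \<notin> set col"
  by (elim cols_cases) (auto simp: weight_col)

lemma weight_eq_minus_1_iff:
  "col \<in> cols c \<Longrightarrow> i \<in> {1, 2} \<Longrightarrow> weight i col = - 1 \<longleftrightarrow> i + 1 \<in> set col \<and> weight i col \<noteq> 0"
  by (elim cols_cases) (auto simp: weight_col)

lemma weight_concat: "weight i (concat (map cs [1..<m + 1])) = bal (\<lambda>c. weight i (cs c)) m"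
  by (induction m) auto

lemma all_take_append:
  "(\<forall>k. P (take k (xs @ ys))) \<longleftrightarrow> (\<forall>k. P (take k xs)) \<and> (\<forall>k. P (xs @ take k ys))"
proof (intro iffI conjI allI)
  fix k assume *: "\<forall>k. P (take k (xs @ ys))"
  show "P (take k xs)"
    using *[rule_format, of "min k (length xs)"] by (simp add: min_def split: if_splits)
  show "P (xs @ take k ys)"
    using *[rule_format, of "length xs + k"] by simp
next
  fix k assume *: "(\<forall>k. P (take k xs)) \<and> (\<forall>k. P (xs @ take k ys))"
  show "P (take k (xs @ ys))"
  proof (cases "k \<le> length xs")
    case True
    then show ?thesis using * by simp
  next
    case False
    then show ?thesis using *[THEN conjunct2, rule_format, of "k - length xs"] by simp
  qed
qed

text \<open>
  After the first box of a two-box column the ballot inequalities follow from those before and after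
  the column: a first entry 1 can only help, and a first entry 2 endangers only the comparison of
  1s with 2s, which the second entry 3 does not affect.
\<close>

lemma ballot_inside_column:
  assumes "col \<in> cols c" and "0 \<le> weight 1 xs" and "0 \<le> weight 2 xs"
  shows "(\<forall>k. 0 \<le> weight 1 (xs @ take k col) \<and> 0 \<le> weight 2 (xs @ take k col))
     \<longleftrightarrow> 0 \<le> weight 1 (xs @ col) \<and> 0 \<le> weight 2 (xs @ col)" (is "?L \<longleftrightarrow> ?R")
proof
  assume ?L
  from this[rule_format, of "length col"] show ?R by simp
next
  assume R: ?R
  have [simp]: "take k [a] = (if k = 0 then [] else [a])" for k and a :: nat
    by (cases k) auto
  have [simp]: "take k [a, b] = (if k = 0 then [] else if k = 1 then [a] else [a, b])"
    for k and a b :: nat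
    by (cases k; cases "k - 1") auto
  show ?L
    using assms(1) by (cases rule: cols_cases) (use assms(2,3) R in \<open>auto simp: weight_col\<close>)
qed

lemma ballot_prefix_iff:
  assumes "\<And>c. c \<in> {1..n} \<Longrightarrow> cs c \<in> cols c"
  shows "(\<forall>k. 0 \<le> weight 1 (take k (concat (map cs [1..<n + 1]))) \<and>
              0 \<le> weight 2 (take k (concat (map cs [1..<n + 1]))))
     \<longleftrightarrow> (\<forall>k\<le>n. 0 \<le> bal (\<lambda>c. weight 1 (cs c)) k \<and> 0 \<le> bal (\<lambda>c. weight 2 (cs c)) k)"
  using assms
proof (induction n)
  case 0
  then show ?case by simp
next
  case (Suc n)
  let ?A = "concat (map cs [1..<n + 1])"
  let ?P = "\<lambda>xs. 0 \<le> weight 1 xs \<and> 0 \<le> weight 2 xs"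
  let ?B = "\<lambda>k. 0 \<le> bal (\<lambda>c. weight 1 (cs c)) k \<and> 0 \<le> bal (\<lambda>c. weight 2 (cs c)) k"
  have eq: "concat (map cs [1..<Suc n + 1]) = ?A @ cs (Suc n)" by simp
  have IH: "(\<forall>k. ?P (take k ?A)) \<longleftrightarrow> (\<forall>k\<le>n. ?B k)"
    using Suc by simp
  have "(\<forall>k. ?P (take k (?A @ cs (Suc n)))) \<longleftrightarrow>
      (\<forall>k. ?P (take k ?A)) \<and> (\<forall>k. ?P (?A @ take k (cs (Suc n))))"
    by (rule all_take_append)
  also have "\<dots> \<longleftrightarrow> (\<forall>k\<le>n. ?B k) \<and> (\<forall>k. ?P (?A @ take k (cs (Suc n))))"
    by (simp only: IH)
  also have "\<dots> \<longleftrightarrow> (\<forall>k\<le>n. ?B k) \<and> ?P (?A @ cs (Suc n))"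
  proof (rule conj_cong[OF refl])
    assume "\<forall>k\<le>n. ?B k"
    then have "?P ?A" by (simp only: weight_concat)
    then show "(\<forall>k. ?P (?A @ take k (cs (Suc n)))) \<longleftrightarrow> ?P (?A @ cs (Suc n))"
      using ballot_inside_column[of "cs (Suc n)" "Suc n" ?A] Suc.prems[of "Suc n"] by simp
  qed
  also have "?P (?A @ cs (Suc n)) \<longleftrightarrow> ?B (Suc n)"
    by (simp only: weight_append weight_concat bal_Suc)
  also have "(\<forall>k\<le>n. ?B k) \<and> ?B (Suc n) \<longleftrightarrow> (\<forall>k\<le>Suc n. ?B k)"
    by (auto simp: le_Suc_eq)
  finally show ?case by (simp only: eq)
qed


section \<open>The automaton\<close>

text \<open>
  The step of a column followed by x pending bonds of type 1 and y of type 2; an opening column is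
  bonded iff the pending number of its type is positive.
\<close>

definition step_of :: "nat list \<Rightarrow> int \<Rightarrow> int \<Rightarrow> vec" where
  "step_of col x y =
     (if col = [1, 2] then if 0 < y then stepN else stepE
      else if col = [1] then if 0 < x then stepN else stepE
      else if col = [1, 3] then if 0 < x then stepE else stepS
      else if col = [2] then if 0 < y then stepE else stepS
      else stepS)"

lemmas step_defs = stepN_def stepE_def stepS_def

lemma step_of_range: "step_of col x y \<in> {stepN, stepE, stepS}"
  by (simp add: step_of_def)

text \<open>
  Going forwards over the column, a bonded opening column starts a bond, a closing column ends one,
  and an unbonded opening column changes nothing because no bond of its type crosses it.
\<close>

lemma step_of_height:
  assumes "col \<in> cols c" "0 \<le> x" "0 \<le> y"
    and "u = max 0 (x - weight 1 col)" "v = max 0 (y - weight 2 col)"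
  shows "step_of col x y = (1, x + y - (u + v))"
  using assms(1) by (cases rule: cols_cases)
    (use assms(2-) in \<open>auto simp: step_of_def step_defs weight_col\<close>)

text \<open>
  The state (u, v) before a column and its step s determine the column and the state after it. In odd
  columns an east step is an unbonded opening column if u = 0; for u > 0 this is impossible, since
  the u pending openings could be closed only after this later one, so the column must end one bond
  and start another. The decision between the two descending columns rests on v
  in the same way, and even columns are the same automaton with the two types exchanged.
\<close>

definition decode :: "nat \<Rightarrow> int \<Rightarrow> int \<Rightarrow> vec \<Rightarrow> nat list \<times> int \<times> int" where
  "decode c u v s =
     (if odd c then
        if s = stepN then ([1], u + 1, v)
        else if s = stepE then if u = 0 then ([1], 0, v) else ([2], u - 1, v + 1)
        else if v = 0 then ([2], u - 1, 0) else ([3], u, v - 1)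
      else
        if s = stepN then ([1, 2], u, v + 1)
        else if s = stepE then if v = 0 then ([1, 2], u, 0) else ([1, 3], u + 1, v - 1)
        else if u = 0 then ([1, 3], 0, v - 1) else ([2, 3], u - 1, v))"

lemma decode_step_of:
  assumes "col \<in> cols c" "0 \<le> x" "0 \<le> y"
    and "u = max 0 (x - weight 1 col)" "v = max 0 (y - weight 2 col)"
  shows "decode c u v (step_of col x y) = (col, x, y)"
  using assms(1)
proof (cases rule: cols_cases)
qed (use assms(2-) in \<open>simp_all add: decode_def step_of_def step_defs weight_col\<close>)

lemma step_of_decode:
  assumes "0 \<le> u" "0 \<le> v" "s \<in> {stepN, stepE, stepS}" "0 \<le> u + v + snd s"
    and "decode c u v s = (col, x, y)"
  shows "col \<in> cols c \<and> 0 \<le> x \<and> 0 \<le> y \<and> u = max 0 (x - weight 1 col) \<and>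
    v = max 0 (y - weight 2 col) \<and> step_of col x y = s"
  using assms
  by (auto simp: decode_def step_of_def step_defs weight_col cols_def split: if_splits)

text \<open>
  The only columns violating the row condition are (1) before (23) and (12) before (3). In both cases
  the second column closes a bond of the type that the first one opens, so the first is bonded and
  the steps are a peak. Conversely, in a peak the first column is bonded; the only descending
  columns allowed after it by the row condition would be unbonded opening columns of the same type,
  which a pending bond excludes.
\<close>

lemma row_condition_iff_no_peak:
  assumes "col \<in> cols c" "col' \<in> cols (Suc c)" "0 \<le> x'" "0 \<le> y'"
    and "x = max 0 (x' - weight 1 col')" "y = max 0 (y' - weight 2 col')"
  shows "hd col' \<le> last col \<longleftrightarrow> \<not> (step_of col x y = stepN \<and> step_of col' x' y' = stepS)"
  using assms(1,2)
  by (elim cols_cases)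
     (use assms(3-) in \<open>simp_all add: step_of_def step_defs weight_col\<close>)


section \<open>Ribbons as sequences of columns\<close>

text \<open>
  Column c meets row i only for c = 2i - 2, 2i - 1, 2i: an odd column is a single box and an even
  column overlaps the rows c / 2 and c / 2 + 1.
\<close>

lemma fib_shape_iff:
  assumes "c \<in> {1..n}"
  shows "(i, n + 1 - c) \<in> fib_shape n \<longleftrightarrow> i \<in> {(c + 1) div 2..c div 2 + 1}"
proof -
  have "(i, n + 1 - c) \<in> fib_shape n \<longleftrightarrow> 1 \<le> i \<and> c \<le> 2 * i \<and> 2 * i \<le> c + 2"
  proof (cases "i = 1")
    case False
    have "n + 1 - c \<le> n - (2 * i - 3) \<longleftrightarrow> 2 * i \<le> c + 2" if "1 \<le> i"
      using assms that False by auto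
    then show ?thesis
      using assms False by (auto simp: fib_shape_def skew_shape_def fib_P_def fib_Q_def)
  qed (use assms in \<open>auto simp: fib_shape_def skew_shape_def fib_P_def fib_Q_def\<close>)
  also have "\<dots> \<longleftrightarrow> i \<in> {(c + 1) div 2..c div 2 + 1}"
  proof -
    have "(c + 1) div 2 \<le> i \<longleftrightarrow> c \<le> 2 * i" "i \<le> c div 2 + 1 \<longleftrightarrow> 2 * i \<le> c + 2"
      by linarith+
    then show ?thesis using assms by auto
  qed
  finally show ?thesis .
qed

lemma fib_shape_column:
  assumes "(i, j) \<in> fib_shape n"
  obtains c where "c \<in> {1..n}" "j = n + 1 - c"
proof
  show "n + 1 - j \<in> {1..n}" "j = n + 1 - (n + 1 - j)"
    using assms unfolding fib_shape_def skew_shape_def fib_P_def fib_Q_def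
    by (auto split: if_splits)
qed

lemma rcol_eq:
  assumes "c \<in> {1..n}"
  shows "rcol n r c = map (\<lambda>i. r (i, n + 1 - c)) [(c + 1) div 2..<c div 2 + 2]"
proof -
  have "{i. (i, n + 1 - c) \<in> fib_shape n} = {(c + 1) div 2..c div 2 + 1}"
    using fib_shape_iff[OF assms] by blast
  also have "\<dots> = {(c + 1) div 2..<c div 2 + 2}" by auto
  finally show ?thesis by (simp only: rcol_def sorted_list_of_set_range)
qed

lemma rcol_odd:
  assumes "c \<in> {1..n}" "odd c"
  shows "rcol n r c = [r (c div 2 + 1, n + 1 - c)]"
proof -
  have "(c + 1) div 2 = c div 2 + 1" using assms by presburger
  then show ?thesis using assms by (simp add: rcol_eq)
qed

lemma rcol_even:
  assumes "c \<in> {1..n}" "even c"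
  shows "rcol n r c = [r (c div 2, n + 1 - c), r (c div 2 + 1, n + 1 - c)]"
proof -
  have "(c + 1) div 2 = c div 2" using assms by presburger
  then show ?thesis using assms by (simp add: rcol_eq)
qed

lemma hd_rcol: "c \<in> {1..n} \<Longrightarrow> hd (rcol n r c) = r ((c + 1) div 2, n + 1 - c)"
  by (cases "even c") (auto simp: rcol_odd rcol_even)

lemma last_rcol: "c \<in> {1..n} \<Longrightarrow> last (rcol n r c) = r (c div 2 + 1, n + 1 - c)"
  by (cases "even c") (auto simp: rcol_odd rcol_even)

lemma rcol_in_cols_iff:
  assumes r: "r \<in> fib_shape n \<rightarrow> {1, 2, 3}" and c: "c \<in> {1..n}"
  shows "rcol n r c \<in> cols c \<longleftrightarrow> odd c \<or> r (c div 2, n + 1 - c) < r (c div 2 + 1, n + 1 - c)"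
proof -
  have "r (c div 2 + 1, n + 1 - c) \<in> {1, 2, 3}"
    using fib_shape_iff[OF c] by (intro Pi_mem[OF r]) auto
  moreover have "r (c div 2, n + 1 - c) \<in> {1, 2, 3}" if "even c"
    using fib_shape_iff[OF c] that by (intro Pi_mem[OF r]) auto
  ultimately show ?thesis
    using c by (cases "even c") (auto simp: rcol_odd rcol_even cols_def)
qed

lemma rcol_inj:
  assumes "r \<in> fib_ribbons n" "r' \<in> fib_ribbons n" "\<And>c. c \<in> {1..n} \<Longrightarrow> rcol n r c = rcol n r' c"
  shows "r = r'"
proof (rule PiE_ext)
  show "r \<in> fib_shape n \<rightarrow>\<^sub>E {1, 2, 3}" "r' \<in> fib_shape n \<rightarrow>\<^sub>E {1, 2, 3}"
    using assms(1,2) by (simp_all add: fib_ribbons_def)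
next
  fix b assume b: "b \<in> fib_shape n"
  obtain i c where "b = (i, n + 1 - c)" "c \<in> {1..n}"
    using b fib_shape_column by (metis surj_pair)
  then show "r b = r' b"
    using assms(3)[of c] b fib_shape_iff[of c n i] by (auto simp: rcol_eq simp del: upt_Suc)
qed

text \<open>
  Neighbouring columns c + 1 and c share exactly one row, in which the former has its top box and the
  latter its bottom box, whatever the parity. The boxes of a row are consecutive, so comparing
  neighbours suffices.
\<close>

lemma semistandard_fib_iff:
  assumes r: "r \<in> fib_shape n \<rightarrow> {1, 2, 3}"
  shows "semistandard (fib_shape n) r \<longleftrightarrow>
    (\<forall>c\<in>{1..n}. rcol n r c \<in> cols c) \<and> (\<forall>c\<in>{1..<n}. hd (rcol n r (Suc c)) \<le> last (rcol n r c))"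
    (is "?L \<longleftrightarrow> ?R")
proof
  assume ?L
  then have row: "\<And>i j k. (i, j) \<in> fib_shape n \<Longrightarrow> (i, k) \<in> fib_shape n \<Longrightarrow> j < k \<Longrightarrow> r (i, j) \<le> r (i, k)"
    and column: "\<And>i j k. (i, j) \<in> fib_shape n \<Longrightarrow> (k, j) \<in> fib_shape n \<Longrightarrow> i < k \<Longrightarrow> r (i, j) < r (k, j)"
    unfolding semistandard_def by blast+
  show ?R
  proof (intro conjI ballI)
    fix c assume c: "c \<in> {1..n}"
    have "r (c div 2, n + 1 - c) < r (c div 2 + 1, n + 1 - c)" if "even c"
      by (rule column) (use that fib_shape_iff[OF c] in auto)
    then show "rcol n r c \<in> cols c"
      using rcol_in_cols_iff[OF r c] by blast
  next
    fix c assume c: "c \<in> {1..<n}"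
    have "(c div 2 + 1, n + 1 - Suc c) \<in> fib_shape n" "(c div 2 + 1, n + 1 - c) \<in> fib_shape n"
      using c fib_shape_iff[of "Suc c" n "c div 2 + 1"] fib_shape_iff[of c n "c div 2 + 1"] by auto
    then have "r (c div 2 + 1, n + 1 - Suc c) \<le> r (c div 2 + 1, n + 1 - c)"
      by (rule row) (use c in auto)
    then show "hd (rcol n r (Suc c)) \<le> last (rcol n r c)"
      using c hd_rcol[of "Suc c" n r] last_rcol[of c n r] by simp
  qed
next
  assume R: ?R
  have step: "r (i, n + 1 - Suc c) \<le> r (i, n + 1 - c)"
    if "c \<in> {1..<n}" "(i, n + 1 - Suc c) \<in> fib_shape n" "(i, n + 1 - c) \<in> fib_shape n" for i c
  proof -
    have "i = c div 2 + 1"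
      using that fib_shape_iff[of "Suc c" n i] fib_shape_iff[of c n i] by auto
    then show ?thesis
      using R that(1) hd_rcol[of "Suc c" n r] last_rcol[of c n r] by force
  qed
  have row: "r (i, j) \<le> r (i, k)"
    if D: "(i, j) \<in> fib_shape n" "(i, k) \<in> fib_shape n" and "j < k" for i j k
  proof -
    obtain d where d: "d \<in> {1..n}" "j = n + 1 - d" using D(1) by (rule fib_shape_column)
    obtain c where c: "c \<in> {1..n}" "k = n + 1 - c" using D(2) by (rule fib_shape_column)
    have "c < d" using \<open>j < k\<close> c d by auto
    have "d \<le> c + 2"
      using D c d fib_shape_iff[of c n i] fib_shape_iff[of d n i] by auto
    with \<open>c < d\<close> consider "d = Suc c" | "d = Suc (Suc c)" by linarith
    then show ?thesis
    proof cases
      case 1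
      then show ?thesis using step[of c i] D c d by auto
    next
      case 2
      then have "(i, n + 1 - Suc c) \<in> fib_shape n"
        using D c d fib_shape_iff[of c n i] fib_shape_iff[of d n i] fib_shape_iff[of "Suc c" n i]
        by auto
      then show ?thesis
        using 2 step[of c i] step[of "Suc c" i] D c d by auto
    qed
  qed
  have column: "r (i, j) < r (k, j)"
    if D: "(i, j) \<in> fib_shape n" "(k, j) \<in> fib_shape n" and "i < k" for i j k
  proof -
    obtain c where c: "c \<in> {1..n}" "j = n + 1 - c" using D(1) by (rule fib_shape_column)
    then have "i \<in> {(c + 1) div 2..c div 2 + 1}" "k \<in> {(c + 1) div 2..c div 2 + 1}"
      using D fib_shape_iff by blast+
    with \<open>i < k\<close> have "even c" "i = c div 2" "k = c div 2 + 1"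
      by (cases "even c"; auto elim!: evenE oddE)+
    then show ?thesis using R c rcol_in_cols_iff[OF r, of c] by auto
  qed
  show ?L
    unfolding semistandard_def using row column by blast
qed

lemma ribbon_of_columns:
  assumes cols: "\<And>c. c \<in> {1..n} \<Longrightarrow> cs c \<in> cols c"
    and rows: "\<And>c. c \<in> {1..<n} \<Longrightarrow> hd (cs (Suc c)) \<le> last (cs c)"
  obtains r where "r \<in> fib_ribbons n" "\<And>c. c \<in> {1..n} \<Longrightarrow> rcol n r c = cs c"
proof
  \<comment> \<open>Row i is the box with index i - (c + 1) div 2 in column c, and c = n + 1 - j.\<close>
  define r where "r = restrict (\<lambda>(i, j). cs (n + 1 - j) ! (i - (n + 2 - j) div 2)) (fib_shape n)"
  have r: "r (i, n + 1 - c) = cs c ! (i - (c + 1) div 2)"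
    if "c \<in> {1..n}" "i \<in> {(c + 1) div 2..c div 2 + 1}" for i c
  proof -
    have "n + 1 - (n + 1 - c) = c" "n + 2 - (n + 1 - c) = c + 1" using that by auto
    then show ?thesis using fib_shape_iff[of c n i] that by (simp add: r_def)
  qed
  show rcol: "rcol n r c = cs c" if c: "c \<in> {1..n}" for c
  proof (cases "even c")
    case True
    then have "(c + 1) div 2 = c div 2" by presburger
    then have "rcol n r c = [cs c ! 0, cs c ! 1]"
      using rcol_even[OF c True] r[OF c, of "c div 2"] r[OF c, of "c div 2 + 1"] by simp
    then show ?thesis using cols[OF c] True by (elim cols_cases) auto
  next
    case False
    then have "(c + 1) div 2 = c div 2 + 1" by presburger
    then have "rcol n r c = [cs c ! 0]"
      using rcol_odd[OF c False] r[OF c, of "c div 2 + 1"] by simp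
    then show ?thesis using cols[OF c] False by (elim cols_cases) auto
  qed
  have val: "r \<in> fib_shape n \<rightarrow> {1, 2, 3}"
  proof
    fix b assume b: "b \<in> fib_shape n"
    obtain i c where ic: "b = (i, n + 1 - c)" "c \<in> {1..n}"
      using b fib_shape_column by (metis surj_pair)
    then have "i \<in> {(c + 1) div 2..c div 2 + 1}" using b fib_shape_iff by blast
    then have "r b \<in> set (rcol n r c)"
      using ic by (auto simp: rcol_eq simp del: upt_Suc)
    then have "r b \<in> set (cs c)" using ic rcol by simp
    then show "r b \<in> {1, 2, 3}" using cols[OF ic(2)] by (elim cols_cases) auto
  qed
  have "semistandard (fib_shape n) r"
    using cols rows by (subst semistandard_fib_iff[OF val]) (auto simp: rcol)
  moreover have "r \<in> extensional (fib_shape n)" by (simp add: r_def)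
  ultimately show "r \<in> fib_ribbons n"
    using val by (auto simp: fib_ribbons_def PiE_iff)
qed

lemma fib_ribbons_cols: "r \<in> fib_ribbons n \<Longrightarrow> c \<in> {1..n} \<Longrightarrow> rcol n r c \<in> cols c"
  using semistandard_fib_iff[of r n] by (auto simp: fib_ribbons_def PiE_iff)

lemma fib_ribbons_rows:
  "r \<in> fib_ribbons n \<Longrightarrow> c \<in> {1..<n} \<Longrightarrow> hd (rcol n r (Suc c)) \<le> last (rcol n r c)"
  using semistandard_fib_iff[of r n] by (auto simp: fib_ribbons_def PiE_iff)


section \<open>Bonds\<close>

text \<open>
  In a ballot-admissible ribbon, the number of bonds of type i crossing the cut after column k.
\<close>

definition pending :: "nat \<Rightarrow> (box \<Rightarrow> nat) \<Rightarrow> nat \<Rightarrow> nat \<Rightarrow> int" where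
  "pending n r i k = excess (\<lambda>c. weight i (rcol n r c)) n k"

lemma mu_eq_iff:
  assumes "y \<in> {1..d}"
  shows "mu n r i y d = mu n r (i + 1) y d \<longleftrightarrow>
    bal (\<lambda>c. weight i (rcol n r c)) (y - 1) = bal (\<lambda>c. weight i (rcol n r c)) d"
proof -
  let ?w = "\<lambda>c. weight i (rcol n r c)"
  have "{1..d} = {1..y - 1} \<union> {y..d}" using assms by auto
  then have "bal ?w d = (\<Sum>c\<in>{1..y - 1} \<union> {y..d}. ?w c)" by (simp add: bal_def)
  also have "\<dots> = bal ?w (y - 1) + (\<Sum>c = y..d. ?w c)"
    using assms by (subst sum.union_disjoint) (auto simp: bal_def)
  also have "(\<Sum>c = y..d. ?w c) = int (mu n r i y d) - int (mu n r (i + 1) y d)"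
    by (simp add: mu_def weight_def sum_subtractf)
  finally show ?thesis by auto
qed

text \<open>
  Equal numbers of i and i + 1 in the columns y to d mean equal prefix sums before y and at d, so the
  maximal such y is the last one before which the prefix sum has its value at d.
\<close>

lemma bond_Some_iff:
  assumes "1 \<le> d"
  shows "bond n r i d = Some c \<longleftrightarrow> i + 1 \<in> set (rcol n r d) \<and> c \<in> {1..d} \<and>
    bal (\<lambda>c. weight i (rcol n r c)) (c - 1) = bal (\<lambda>c. weight i (rcol n r c)) d \<and>
    (\<forall>z\<in>{c..<d}. bal (\<lambda>c. weight i (rcol n r c)) z \<noteq> bal (\<lambda>c. weight i (rcol n r c)) d)"
proof -
  define Y where "Y = {y \<in> {1..d}. mu n r i y d = mu n r (i + 1) y d}"
  have Y: "Y = {y \<in> {1..d}. bal (\<lambda>c. weight i (rcol n r c)) (y - 1) = bal (\<lambda>c. weight i (rcol n r c)) d}"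
    unfolding Y_def using mu_eq_iff by blast
  have "finite Y" and Y_le: "\<And>y. y \<in> Y \<Longrightarrow> y \<le> d" by (simp_all add: Y_def)
  have "bond n r i d = Some c \<longleftrightarrow> i + 1 \<in> set (rcol n r d) \<and> Y \<noteq> {} \<and> Max Y = c"
    unfolding bond_def Let_def Y_def[symmetric] by auto
  also have "\<dots> \<longleftrightarrow> i + 1 \<in> set (rcol n r d) \<and> c \<in> Y \<and> (\<forall>y\<in>Y. y \<le> c)"
    using \<open>finite Y\<close> Max_eq_iff by (metis Max_in Max_ge empty_iff)
  also have "\<dots> \<longleftrightarrow> i + 1 \<in> set (rcol n r d) \<and> c \<in> Y \<and> (\<forall>y\<in>{c<..d}. y \<notin> Y)"
    using Y_le by (metis greaterThanAtMost_iff not_le)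
  also have "(\<forall>y\<in>{c<..d}. y \<notin> Y) \<longleftrightarrow> (\<forall>z\<in>{c..<d}. Suc z \<notin> Y)"
  proof (intro iffI ballI)
    fix y assume "\<forall>z\<in>{c..<d}. Suc z \<notin> Y" "y \<in> {c<..d}"
    then show "y \<notin> Y" by (cases y) auto
  qed auto
  finally show ?thesis by (auto simp: Y)
qed

text \<open>
  A bond from a later column d forces d to be a closing column: if d were neutral, its bond would
  be d itself. This leaves the situation of \<open>first_return_iff\<close>.
\<close>

lemma bonded_later_iff:
  assumes cols: "\<And>c. c \<in> {1..n} \<Longrightarrow> rcol n r c \<in> cols c" and c: "c \<in> {1..n}" and i: "i \<in> {1, 2}"
  shows "(\<exists>d\<in>{c<..n}. bond n r i d = Some c) \<longleftrightarrow> weight i (rcol n r c) = 1 \<and> 0 < pending n r i c"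
proof -
  let ?w = "\<lambda>c. weight i (rcol n r c)"
  obtain k where k: "c = Suc k" "k < n" using c by (cases c) auto
  have "bond n r i d = Some c \<longleftrightarrow>
      ?w d = - 1 \<and> bal ?w k = bal ?w d \<and> (\<forall>z\<in>{Suc k..<d}. bal ?w z \<noteq> bal ?w d)"
    if d: "d \<in> {c<..n}" for d
  proof -
    obtain e where e: "d = Suc e" "Suc k \<le> e" using d k by (cases d) auto
    have *: "bond n r i d = Some c \<longleftrightarrow> i + 1 \<in> set (rcol n r d) \<and> bal ?w k = bal ?w d \<and>
        (\<forall>z\<in>{Suc k..<d}. bal ?w z \<noteq> bal ?w d)"
      using d k by (subst bond_Some_iff) auto
    have "?w d \<noteq> 0" if "\<forall>z\<in>{Suc k..<d}. bal ?w z \<noteq> bal ?w d"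
      using that[rule_format, of e] e by auto
    then show ?thesis
      unfolding * using weight_eq_minus_1_iff[OF cols i, of d] d by auto
  qed
  then show ?thesis
    using first_return_iff[of n ?w k] abs_weight_col[OF cols i] k by (simp add: pending_def)
qed

lemma bonded_iff:
  assumes cols: "\<And>c. c \<in> {1..n} \<Longrightarrow> rcol n r c \<in> cols c" and c: "c \<in> {1..n}"
  shows "bonded n r c \<longleftrightarrow> (\<exists>i\<in>{1, 2}. weight i (rcol n r c) = 1 \<and> 0 < pending n r i c)"
proof -
  have "bonded n r c \<longleftrightarrow> (\<exists>i\<in>{1, 2}. \<exists>d\<in>{c<..n}. bond n r i d = Some c)"
    using c by (fastforce simp: bonded_def)
  then show ?thesis using bonded_later_iff[OF cols c] by simp
qed

text \<open>
  The definition excludes bonds from all columns, but a bond never comes from an earlier column, and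
  an opening column is not its own bond since it contains no i + 1.
\<close>

lemma unbonded_iff:
  assumes cols: "\<And>c. c \<in> {1..n} \<Longrightarrow> rcol n r c \<in> cols c" and c: "c \<in> {1..n}"
  shows "unbonded n r c \<longleftrightarrow> (\<exists>i\<in>{1, 2}. weight i (rcol n r c) = 1 \<and> \<not> 0 < pending n r i c)"
proof -
  have "(i \<in> set (rcol n r c) \<and> i + 1 \<notin> set (rcol n r c) \<and> \<not> (\<exists>d\<in>{1..n}. bond n r i d = Some c)) \<longleftrightarrow>
      weight i (rcol n r c) = 1 \<and> \<not> 0 < pending n r i c" if i: "i \<in> {1, 2}" for i
  proof -
    have "(\<exists>d\<in>{1..n}. bond n r i d = Some c) \<longleftrightarrow> (\<exists>d\<in>{c<..n}. bond n r i d = Some c)"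
      if "i + 1 \<notin> set (rcol n r c)"
    proof -
      have "c < d" if "d \<in> {1..n}" "bond n r i d = Some c" for d
      proof -
        have "c \<le> d" "i + 1 \<in> set (rcol n r d)" using that bond_Some_iff[of d n r i c] by auto
        then show ?thesis using \<open>i + 1 \<notin> set (rcol n r c)\<close> by (cases "c = d") auto
      qed
      then show ?thesis using c by force
    qed
    then show ?thesis
      using bonded_later_iff[OF cols c i] weight_eq_1_iff[OF cols[OF c] i] by blast
  qed
  then show ?thesis unfolding unbonded_def by blast
qed

lemma phi_step_eq_step_of:
  assumes cols: "\<And>c. c \<in> {1..n} \<Longrightarrow> rcol n r c \<in> cols c" and c: "c \<in> {1..n}"
  shows "phi_step n r c = step_of (rcol n r c) (pending n r 1 c) (pending n r 2 c)"
proof -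
  have "bonded n r c \<longleftrightarrow> (\<exists>i\<in>{1, 2}. weight i (rcol n r c) = 1 \<and> 0 < pending n r i c)"
    by (rule bonded_iff) (use assms in auto)
  moreover have "unbonded n r c \<longleftrightarrow> (\<exists>i\<in>{1, 2}. weight i (rcol n r c) = 1 \<and> \<not> 0 < pending n r i c)"
    by (rule unbonded_iff) (use assms in auto)
  ultimately show ?thesis
    using cols[OF c]
    by (elim cols_cases) (simp_all add: phi_step_def Let_def step_of_def weight_col)
qed

lemma pending_nonneg: "k \<le> n \<Longrightarrow> 0 \<le> pending n r i k"
  by (simp add: pending_def excess_nonneg)

lemma pending_end [simp]: "pending n r i n = 0"
  by (simp add: pending_def)

lemma pending_step:
  "k < n \<Longrightarrow> pending n r i k = max 0 (pending n r i (Suc k) - weight i (rcol n r (Suc k)))"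
  by (simp add: pending_def excess_step)

text \<open>
  No closing column lacks a partner iff the prefix sums never fall below their initial value 0.
\<close>

lemma ballot_admissible_iff:
  assumes cols: "\<And>c. c \<in> {1..n} \<Longrightarrow> rcol n r c \<in> cols c"
  shows "ballot_admissible n r \<longleftrightarrow> pending n r 1 0 = 0 \<and> pending n r 2 0 = 0"
proof -
  have "ballot_admissible n r \<longleftrightarrow>
      (\<forall>k. 0 \<le> weight 1 (take k (linear_form n r)) \<and> 0 \<le> weight 2 (take k (linear_form n r)))"
    by (simp add: ballot_admissible_def weight_def numeral_2_eq_2 numeral_3_eq_3)
  also have "\<dots> \<longleftrightarrow> (\<forall>k\<le>n. 0 \<le> bal (\<lambda>c. weight 1 (rcol n r c)) k \<and> 0 \<le> bal (\<lambda>c. weight 2 (rcol n r c)) k)"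
    unfolding linear_form_def by (rule ballot_prefix_iff[OF cols])
  also have "\<dots> \<longleftrightarrow> pending n r 1 0 = 0 \<and> pending n r 2 0 = 0"
    unfolding pending_def excess_0_iff by blast
  finally show ?thesis .
qed


section \<open>The bijection\<close>

lemma walk_pos_Suc: "k < length p \<Longrightarrow> walk_pos p (Suc k) = walk_pos p k + p ! k"
  by (simp add: walk_pos_def take_Suc_conv_app_nth)

lemma phi_nth: "k < n \<Longrightarrow> phi n r ! k = phi_step n r (Suc k)"
  by (simp add: phi_def del: upt_Suc)

lemma length_phi [simp]: "length (phi n r) = n"
  by (simp add: phi_def)

lemma ballot_fib_ribbons_iff:
  "r \<in> ballot_fib_ribbons n \<longleftrightarrow> r \<in> fib_ribbons n \<and> pending n r 1 0 = 0 \<and> pending n r 2 0 = 0"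
  using ballot_admissible_iff[of n r] fib_ribbons_cols[of r n] by (auto simp: ballot_fib_ribbons_def)

lemma phi_nth_fib_ribbon:
  assumes "r \<in> fib_ribbons n" "k < n"
  shows "phi n r ! k = step_of (rcol n r (Suc k)) (pending n r 1 (Suc k)) (pending n r 2 (Suc k))"
  using phi_step_eq_step_of[OF fib_ribbons_cols[OF assms(1)], of "Suc k"] assms(2)
  by (simp add: phi_nth)

lemma walk_pos_phi:
  assumes r: "r \<in> ballot_fib_ribbons n" and "k \<le> n"
  shows "walk_pos (phi n r) k = (int k, pending n r 1 k + pending n r 2 k)"
  using assms(2)
proof (induction k)
  case 0
  then show ?case using r by (simp add: walk_pos_def ballot_fib_ribbons_iff zero_prod_def)
next
  case (Suc k)
  then have "phi n r ! k = (1, pending n r 1 (Suc k) + pending n r 2 (Suc k) - (pending n r 1 k + pending n r 2 k))"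
    using r fib_ribbons_cols[of r n "Suc k"]
    by (subst phi_nth_fib_ribbon)
       (auto simp: ballot_fib_ribbons_iff pending_nonneg pending_step intro!: step_of_height)
  then show ?case using Suc by (simp add: walk_pos_Suc)
qed

lemma phi_in_peakless_motzkin_paths:
  assumes r: "r \<in> ballot_fib_ribbons n"
  shows "phi n r \<in> peakless_motzkin_paths n"
proof -
  have fr: "r \<in> fib_ribbons n" using r by (simp add: ballot_fib_ribbons_iff)
  have "set (phi n r) \<subseteq> {stepN, stepE, stepS}"
    using step_of_range by (fastforce simp: set_conv_nth phi_nth_fib_ribbon[OF fr])
  moreover have "\<not> (phi n r ! k = stepN \<and> phi n r ! (k + 1) = stepS)" if "k + 1 < n" for k
  proof -
    have "hd (rcol n r (Suc (Suc k))) \<le> last (rcol n r (Suc k))"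
      using fib_ribbons_rows[OF fr, of "Suc k"] that by simp
    then show ?thesis
      using that fib_ribbons_cols[OF fr, of "Suc k"] fib_ribbons_cols[OF fr, of "Suc (Suc k)"]
        row_condition_iff_no_peak[of "rcol n r (Suc k)" "Suc k" "rcol n r (Suc (Suc k))"
          "pending n r 1 (Suc (Suc k))" "pending n r 2 (Suc (Suc k))"
          "pending n r 1 (Suc k)" "pending n r 2 (Suc k)"]
      by (simp add: phi_nth_fib_ribbon[OF fr] pending_nonneg pending_step[of "Suc k"])
  qed
  ultimately show ?thesis
    using walk_pos_phi[OF r] by (simp add: peakless_motzkin_paths_def pending_nonneg)
qed

lemma decode_phi:
  assumes "r \<in> fib_ribbons n" "k < n"
  shows "decode (Suc k) (pending n r 1 k) (pending n r 2 k) (phi n r ! k) =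
    (rcol n r (Suc k), pending n r 1 (Suc k), pending n r 2 (Suc k))"
  using assms fib_ribbons_cols[of r n "Suc k"]
  by (subst phi_nth_fib_ribbon) (auto intro!: decode_step_of pending_nonneg pending_step)

text \<open>
  Both ribbons start from the state (0, 0), so decoding the common path gives the same states and
  columns.
\<close>

lemma phi_inj: "inj_on (phi n) (ballot_fib_ribbons n)"
proof (rule inj_onI)
  fix r r' assume r: "r \<in> ballot_fib_ribbons n" and r': "r' \<in> ballot_fib_ribbons n" and eq: "phi n r = phi n r'"
  then have fr: "r \<in> fib_ribbons n" and fr': "r' \<in> fib_ribbons n"
    by (simp_all add: ballot_fib_ribbons_iff)
  have same: "pending n r 1 k = pending n r' 1 k \<and> pending n r 2 k = pending n r' 2 k" if "k \<le> n" for k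
    using that
  proof (induction k)
    case 0
    then show ?case using r r' by (simp add: ballot_fib_ribbons_iff)
  next
    case (Suc k)
    then show ?case using decode_phi[OF fr, of k] decode_phi[OF fr', of k] eq by simp
  qed
  show "r = r'"
  proof (rule rcol_inj[OF fr fr'])
    fix c assume "c \<in> {1..n}"
    then obtain k where "c = Suc k" "k < n" by (cases c) auto
    then show "rcol n r c = rcol n r' c"
      using decode_phi[OF fr, of k] decode_phi[OF fr', of k] same[of k] eq by simp
  qed
qed

text \<open>
  The initial column is a dummy: there is no column 0.
\<close>

primrec run :: "vec list \<Rightarrow> nat \<Rightarrow> nat list \<times> int \<times> int" where
  "run p 0 = ([], 0, 0)"
| "run p (Suc k) = (case run p k of (_, u, v) \<Rightarrow> decode (Suc k) u v (p ! k))"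

lemma phi_surj:
  assumes p: "p \<in> peakless_motzkin_paths n"
  obtains r where "r \<in> ballot_fib_ribbons n" "phi n r = p"
proof -
  define cs where "cs k = fst (run p k)" for k
  define X where "X k = fst (snd (run p k))" for k
  define Y where "Y k = snd (snd (run p k))" for k
  have len: "length p = n" and end_height: "snd (walk_pos p n) = 0"
    and height: "\<And>k. k \<le> n \<Longrightarrow> 0 \<le> snd (walk_pos p k)"
    and set: "set p \<subseteq> {stepN, stepE, stepS}"
    and peakless: "\<And>k. k + 1 < n \<Longrightarrow> \<not> (p ! k = stepN \<and> p ! (k + 1) = stepS)"
    using p by (auto simp: peakless_motzkin_paths_def)
  have steps: "p ! k \<in> {stepN, stepE, stepS}" if "k < n" for k
    using set that len nth_mem by blast
  have run: "decode (Suc k) (X k) (Y k) (p ! k) = (cs (Suc k), X (Suc k), Y (Suc k))" for k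
    by (simp add: cs_def X_def Y_def split: prod.splits)
  \<comment> \<open>The state entering a column and the transition through it are proved together: the transition
    needs a nonnegative state, and its height change gives the next value of the sum.\<close>
  have state: "0 \<le> X k \<and> 0 \<le> Y k \<and> X k + Y k = snd (walk_pos p k) \<and>
      (k < n \<longrightarrow> cs (Suc k) \<in> cols (Suc k) \<and> 0 \<le> X (Suc k) \<and> 0 \<le> Y (Suc k) \<and>
        X k = max 0 (X (Suc k) - weight 1 (cs (Suc k))) \<and> Y k = max 0 (Y (Suc k) - weight 2 (cs (Suc k))) \<and>
        step_of (cs (Suc k)) (X (Suc k)) (Y (Suc k)) = p ! k)"
    if "k \<le> n" for k
    using that
  proof (induction k)
    case 0
    have *: "X 0 = 0" "Y 0 = 0" by (simp_all add: X_def Y_def)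
    have "0 \<le> snd (p ! 0)" if "0 < n" using height[of 1] that len walk_pos_Suc[of 0 p] by (simp add: walk_pos_def)
    then show ?case
      using * step_of_decode[OF _ _ steps[of 0] _ run] by (auto simp: walk_pos_def)
  next
    case (Suc k)
    then have IH: "X k + Y k = snd (walk_pos p k)" "cs (Suc k) \<in> cols (Suc k)" "0 \<le> X (Suc k)" "0 \<le> Y (Suc k)"
        "X k = max 0 (X (Suc k) - weight 1 (cs (Suc k)))" "Y k = max 0 (Y (Suc k) - weight 2 (cs (Suc k)))"
        "step_of (cs (Suc k)) (X (Suc k)) (Y (Suc k)) = p ! k"
      by auto
    have "p ! k = (1, X (Suc k) + Y (Suc k) - (X k + Y k))"
      using step_of_height[OF IH(2-6)] IH(7) by simp
    then have sum: "X (Suc k) + Y (Suc k) = snd (walk_pos p (Suc k))"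
      using IH(1) Suc.prems len by (simp add: walk_pos_Suc)
    moreover have "0 \<le> X (Suc k) + Y (Suc k) + snd (p ! Suc k)" if "Suc k < n"
      using height[of "Suc (Suc k)"] sum that len by (simp add: walk_pos_Suc)
    ultimately show ?case
      using IH(3,4) step_of_decode[OF IH(3,4) steps[of "Suc k"] _ run] by blast
  qed
  have cols: "cs c \<in> cols c" if "c \<in> {1..n}" for c
    using that state[of "c - 1"] by (cases c) auto
  have rows: "hd (cs (Suc c)) \<le> last (cs c)" if c: "c \<in> {1..<n}" for c
  proof -
    obtain k where k: "c = Suc k" using c by (cases c) auto
    show ?thesis
      using c k state[of k] state[of c] peakless[of k]
        row_condition_iff_no_peak[of "cs c" c "cs (Suc c)" "X (Suc c)" "Y (Suc c)" "X c" "Y c"]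
      by auto
  qed
  obtain r where r: "r \<in> fib_ribbons n" and rcol: "\<And>c. c \<in> {1..n} \<Longrightarrow> rcol n r c = cs c"
    using ribbon_of_columns[OF cols rows] by blast
  have "X n = 0" "Y n = 0" using state[of n] end_height by auto
  have X: "X k = pending n r 1 k" if "k \<le> n" for k
    unfolding pending_def
    by (rule excess_unique) (use that \<open>X n = 0\<close> state in \<open>auto simp: rcol\<close>)
  have Y: "Y k = pending n r 2 k" if "k \<le> n" for k
    unfolding pending_def
    by (rule excess_unique) (use that \<open>Y n = 0\<close> state in \<open>auto simp: rcol\<close>)
  show thesis
  proof
    have "X 0 = 0" "Y 0 = 0" by (simp_all add: X_def Y_def)
    then show "r \<in> ballot_fib_ribbons n"
      using r X[of 0] Y[of 0] by (simp add: ballot_fib_ribbons_iff)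
    show "phi n r = p"
    proof (rule nth_equalityI)
      show "length (phi n r) = length p" by (simp add: len)
      fix k assume "k < length (phi n r)"
      then show "phi n r ! k = p ! k"
        using phi_nth_fib_ribbon[OF r, of k] state[of k] X[of "Suc k"] Y[of "Suc k"] rcol[of "Suc k"]
        by simp
    qed
  qed
qed

theorem theorem3p3p11:
  fixes n :: nat
  assumes "n \<ge> 1"
  shows "bij_betw (phi n) (ballot_fib_ribbons n) (peakless_motzkin_paths n)"
  unfolding bij_betw_def
  using phi_inj phi_in_peakless_motzkin_paths phi_surj
  by (metis image_eqI subset_antisym subsetI image_subset_iff)

end
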